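(* Let $R$ be a nonzero ring. The family $\mathcal{F}$ of ideals $I$ of $R$ that are faithful as left $R$-modules satisfies $(P_1)$. If $R$ satisfies the ascending chain condition on (two-sided) ideals, then $R$ is a prime ring if and only if every nonzero prime ideal of $R$ is faithful as a left $R$-module.
   Context: Rings are associative and unital, not necessarily commutative; "ideal" means two-sided ideal. An ideal $I$ is faithful as a left $R$-module if $rI=0$ with $r\in R$ implies $r=0$. A family $\mathcal{F}$ of ideals of $R$ satisfies $(P_1)$ if $R\in\mathcal{F}$, $\mathcal{F}$ is closed under products ($I,J\in\mathcal{F}\Rightarrow IJ\in\mathcal{F}$), and $\mathcal{F}$ is upward closed ($I\in\mathcal{F}$ and $J\supseteq I$ an ideal imply $J\in\mathcal{F}$). *)

theory Defs
  imports "HOL-Algebra.Ideal_Product"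
begin

text \<open>The library locale \<^locale>\<open>primeideal\<close> is tied to commutative rings (it extends
  \<^locale>\<open>cring\<close> and tests elements), so primeness in an arbitrary ring is defined here through
  products of two-sided ideals.\<close>

locale twosided_prime_ideal = ideal P R for P and R (structure) +
  assumes proper: "P \<noteq> carrier R"
    and prime: "\<lbrakk>ideal I R; ideal J R; ideal_prod R I J \<subseteq> P\<rbrakk> \<Longrightarrow> I \<subseteq> P \<or> J \<subseteq> P"

definition prime_ring :: "('a, 'b) ring_scheme \<Rightarrow> bool" where
  "prime_ring R \<longleftrightarrow> ring R \<and> twosided_prime_ideal {\<zero>\<^bsub>R\<^esub>} R"

definition left_faithful :: "('a, 'b) ring_scheme \<Rightarrow> 'a set \<Rightarrow> bool" where
  "left_faithful R I \<longleftrightarrow>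
     (\<forall>r\<in>carrier R. (\<forall>x\<in>I. r \<otimes>\<^bsub>R\<^esub> x = \<zero>\<^bsub>R\<^esub>) \<longrightarrow> r = \<zero>\<^bsub>R\<^esub>)"

definition satisfies_P1 :: "('a, 'b) ring_scheme \<Rightarrow> 'a set set \<Rightarrow> bool" where
  "satisfies_P1 R \<F> \<longleftrightarrow>
     (\<forall>I\<in>\<F>. ideal I R) \<and>
     carrier R \<in> \<F> \<and>
     (\<forall>I\<in>\<F>. \<forall>J\<in>\<F>. ideal_prod R I J \<in> \<F>) \<and>
     (\<forall>I\<in>\<F>. \<forall>J. ideal J R \<and> I \<subseteq> J \<longrightarrow> J \<in> \<F>)"

definition acc_on_ideals :: "('a, 'b) ring_scheme \<Rightarrow> bool" where
  "acc_on_ideals R \<longleftrightarrow>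
     (\<forall>I :: nat \<Rightarrow> 'a set.
        (\<forall>n. ideal (I n) R) \<and> (\<forall>n. I n \<subseteq> I (Suc n)) \<longrightarrow> (\<exists>m. \<forall>n\<ge>m. I n = I m))"

end

theory Submission
  imports Defs
begin

text \<open>An ideal maximal in the complement of a family with \<open>(P\<^sub>1)\<close> is prime. If \<open>R\<close> is not prime,
  then \<open>I J = 0\<close> for some nonzero ideals \<open>I\<close>, \<open>J\<close>, so \<open>J\<close> is not left faithful; by the ascending
  chain condition it lies in a maximal non-faithful ideal, which is then a nonzero prime.
  Conversely, the left annihilator of an ideal \<open>P\<close> is an ideal whose product with \<open>P\<close> is zero,
  so in a prime ring it vanishes when \<open>P\<close> is nonzero.\<close>

text \<open>Since \<open>P\<close> is closed under addition, only the generators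
  \<open>i \<otimes> j\<close> of the product matter. Later inclusions of ideal products are thereby
  checked on elements.\<close>

lemma (in ring) ideal_prod_subset_iff:
  assumes "ideal P R"
  shows "ideal_prod R I J \<subseteq> P \<longleftrightarrow> (\<forall>i\<in>I. \<forall>j\<in>J. i \<otimes> j \<in> P)"
proof (intro iffI subsetI)
  assume "ideal_prod R I J \<subseteq> P"
  then show "\<forall>i\<in>I. \<forall>j\<in>J. i \<otimes> j \<in> P"
    by (auto intro: ideal_prod.prod)
next
  fix s assume "\<forall>i\<in>I. \<forall>j\<in>J. i \<otimes> j \<in> P" and "s \<in> ideal_prod R I J"
  from this(2) this(1) show "s \<in> P"
    by induction (auto intro: additive_subgroup.a_closed[OF ideal.axioms(1)[OF assms]])
qed

lemma (in ring) ideal_sum_upper: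
  assumes "ideal I R" "ideal J R"
  shows "I \<subseteq> I <+> J" "J \<subseteq> I <+> J"
proof -
  interpret I: ideal I R by (rule assms)
  interpret J: ideal J R by (rule assms)
  show "I \<subseteq> I <+> J"
  proof
    fix x assume "x \<in> I"
    then have "x = x \<oplus> \<zero>" by (simp add: I.Icarr)
    then show "x \<in> I <+> J"
      unfolding set_add_def' using \<open>x \<in> I\<close> J.zero_closed by blast
  qed
  show "J \<subseteq> I <+> J"
  proof
    fix x assume "x \<in> J"
    then have "x = \<zero> \<oplus> x" by (simp add: J.Icarr)
    then show "x \<in> I <+> J"
      unfolding set_add_def' using \<open>x \<in> J\<close> I.zero_closed by blast
  qed
qed

text \<open>When \<open>(p \<oplus> i) \<otimes> (q \<oplus> j)\<close> is expanded, every term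
  except \<open>i \<otimes> j\<close> has a factor in \<open>P\<close>, and
  \<open>i \<otimes> j\<close> lies in \<open>P\<close> by hypothesis.\<close>

lemma (in ring) ideal_prod_sums_subset:
  assumes P: "ideal P R" and I: "ideal I R" and J: "ideal J R"
    and IJ: "ideal_prod R I J \<subseteq> P"
  shows "ideal_prod R (P <+> I) (P <+> J) \<subseteq> P"
proof -
  interpret P: ideal P R by (rule P)
  have "(p \<oplus> i) \<otimes> (q \<oplus> j) \<in> P" if "p \<in> P" "i \<in> I" "q \<in> P" "j \<in> J" for p i q j
  proof -
    have carr: "p \<in> carrier R" "i \<in> carrier R" "q \<in> carrier R" "j \<in> carrier R"
      using that P.Icarr ideal.Icarr[OF I] ideal.Icarr[OF J] by auto
    have "i \<otimes> j \<in> P"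
      using IJ that by (auto simp: ideal_prod_subset_iff[OF P])
    moreover have "p \<otimes> (q \<oplus> j) \<in> P" "i \<otimes> q \<in> P"
      using that carr by (auto intro: P.I_l_closed P.I_r_closed)
    moreover have "(p \<oplus> i) \<otimes> (q \<oplus> j) = p \<otimes> (q \<oplus> j) \<oplus> (i \<otimes> q \<oplus> i \<otimes> j)"
      using carr by (simp add: l_distr r_distr a_ac)
    ultimately show ?thesis
      by (simp add: P.a_closed)
  qed
  then show ?thesis
    unfolding ideal_prod_subset_iff[OF P] set_add_def' by blast
qed

text \<open>If no such maximal member existed, every member above \<open>I\<close> could be properly
  enlarged, and dependent choice would build a strictly ascending chain of ideals.\<close>

lemma acc_on_ideals_maximal:
  assumes acc: "acc_on_ideals R"
    and ideals: "\<And>I. I \<in> \<S> \<Longrightarrow> ideal I R"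
    and I: "I \<in> \<S>"
  obtains M where "M \<in> \<S>" "I \<subseteq> M" "\<And>J. J \<in> \<S> \<Longrightarrow> M \<subseteq> J \<Longrightarrow> J = M"
proof (rule ccontr)
  assume "\<not> thesis"
  then have step: "\<exists>J. (J \<in> \<S> \<and> I \<subseteq> J) \<and> M \<subset> J" if "M \<in> \<S> \<and> I \<subseteq> M" for M
    using that \<open>\<And>M. \<lbrakk>M \<in> \<S>; I \<subseteq> M; \<And>J. J \<in> \<S> \<Longrightarrow> M \<subseteq> J \<Longrightarrow> J = M\<rbrakk> \<Longrightarrow> thesis\<close>
    by blast
  have "\<exists>f :: nat \<Rightarrow> _. \<forall>n. (f n \<in> \<S> \<and> I \<subseteq> f n) \<and> f n \<subset> f (Suc n)"
    using I step by (intro dependent_nat_choice) auto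
  then obtain f :: "nat \<Rightarrow> _" where f: "\<And>n. f n \<in> \<S>" "\<And>n. f n \<subset> f (Suc n)"
    by blast
  have "(\<forall>n. ideal (f n) R) \<and> (\<forall>n. f n \<subseteq> f (Suc n))"
    using f ideals by (simp add: psubset_imp_subset)
  then obtain m where "\<forall>n\<ge>m. f n = f m"
    using acc unfolding acc_on_ideals_def by blast
  then have "f (Suc m) = f m"
    by (meson le_SucI order_refl)
  then show False
    using f(2)[of m] by simp
qed

lemma (in ring) P1_maximal_complement_prime:
  assumes P1: "satisfies_P1 R \<F>"
    and P: "ideal P R" "P \<notin> \<F>"
    and max: "\<And>J. \<lbrakk>ideal J R; J \<notin> \<F>; P \<subseteq> J\<rbrakk> \<Longrightarrow> J = P"
  shows "twosided_prime_ideal P R"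
proof (rule twosided_prime_ideal.intro[OF P(1)], unfold_locales)
  show "P \<noteq> carrier R"
    using P1 P(2) by (auto simp: satisfies_P1_def)
next
  fix I J
  assume I: "ideal I R" and J: "ideal J R" and IJ: "ideal_prod R I J \<subseteq> P"
  \<comment> \<open>Otherwise maximality forces \<open>P <+> K = P\<close>, and then
    \<open>K \<subseteq> P\<close>.\<close>
  have sum_in: "P <+> K \<in> \<F>" if "ideal K R" "\<not> K \<subseteq> P" for K
    using max[OF add_ideals[OF P(1) that(1)]] ideal_sum_upper[OF P(1) that(1)] that(2) by blast
  show "I \<subseteq> P \<or> J \<subseteq> P"
  proof (rule ccontr)
    assume "\<not> (I \<subseteq> P \<or> J \<subseteq> P)"
    then have "P <+> I \<in> \<F>" "P <+> J \<in> \<F>"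
      using sum_in[OF I] sum_in[OF J] by blast+
    then have "ideal_prod R (P <+> I) (P <+> J) \<in> \<F>"
      using P1 unfolding satisfies_P1_def by blast
    \<comment> \<open>The product of the two sums is a member of the family contained in
      \<open>P\<close>, so upward closure applies.\<close>
    then have "P \<in> \<F>"
      using ideal_prod_sums_subset[OF P(1) I J IJ] P(1) P1 unfolding satisfies_P1_def by blast
    then show False
      using P(2) by contradiction
  qed
qed

lemma (in ring) left_faithful_satisfies_P1:
  "satisfies_P1 R {I. ideal I R \<and> left_faithful R I}"
  unfolding satisfies_P1_def
proof (intro conjI ballI allI impI; clarsimp)
  show "ideal (carrier R) R \<and> left_faithful R (carrier R)"
    unfolding left_faithful_def using oneideal one_closed r_one by metis
next
  fix I J
  assume I: "ideal I R" "left_faithful R I" and J: "ideal J R" "left_faithful R J"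
  have "r = \<zero>" if r: "r \<in> carrier R" and ann: "\<forall>x\<in>ideal_prod R I J. r \<otimes> x = \<zero>" for r
  proof -
    \<comment> \<open>Reassociating lets faithfulness of \<open>J\<close> kill
      \<open>r \<otimes> i\<close>; faithfulness of \<open>I\<close> then kills
      \<open>r\<close>.\<close>
    have "(r \<otimes> i) \<otimes> j = \<zero>" if "i \<in> I" "j \<in> J" for i j
      using ann that r ideal.Icarr[OF I(1)] ideal.Icarr[OF J(1)]
      by (simp add: m_assoc ideal_prod.prod)
    then have "r \<otimes> i = \<zero>" if "i \<in> I" for i
      using J(2) that r ideal.Icarr[OF I(1)] by (simp add: left_faithful_def)
    then show ?thesis
      using I(2) r by (simp add: left_faithful_def)
  qed
  then show "ideal (ideal_prod R I J) R \<and> left_faithful R (ideal_prod R I J)"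
    using ideal_prod_is_ideal[OF I(1) J(1)] by (auto simp: left_faithful_def)
next
  fix I J assume "left_faithful R I" "I \<subseteq> J"
  then show "left_faithful R J"
    unfolding left_faithful_def by blast
qed

lemma (in ring) left_annihilator_ideal:
  assumes "ideal I R"
  shows "ideal {r \<in> carrier R. \<forall>x\<in>I. r \<otimes> x = \<zero>} R"
proof (rule idealI[OF ring_axioms])
  interpret I: ideal I R by (rule assms)
  show "subgroup {r \<in> carrier R. \<forall>x\<in>I. r \<otimes> x = \<zero>} (add_monoid R)"
    \<comment> \<open>Folding \<open>a_inv_def\<close> turns inverses of \<open>add_monoid R\<close>
      back into \<open>\<ominus>\<close>, so that \<open>l_minus\<close> applies.\<close>
    by (rule add.subgroupI) (auto simp: I.Icarr l_distr l_minus simp flip: a_inv_def)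
  fix a y assume "a \<in> {r \<in> carrier R. \<forall>x\<in>I. r \<otimes> x = \<zero>}" "y \<in> carrier R"
  \<comment> \<open>Closure under right multiplication uses that \<open>I\<close> absorbs on the
    left: \<open>(a \<otimes> y) \<otimes> x = a \<otimes> (y \<otimes> x)\<close> with
    \<open>y \<otimes> x\<close> in \<open>I\<close>.\<close>
  then show "y \<otimes> a \<in> {r \<in> carrier R. \<forall>x\<in>I. r \<otimes> x = \<zero>}"
    and "a \<otimes> y \<in> {r \<in> carrier R. \<forall>x\<in>I. r \<otimes> x = \<zero>}"
    by (auto simp: I.Icarr I.I_l_closed m_assoc)
qed

lemma (in ring) prime_ring_left_faithful:
  assumes "prime_ring R" "ideal I R" "I \<noteq> {\<zero>}"
  shows "left_faithful R I"
proof -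
  let ?A = "{r \<in> carrier R. \<forall>x\<in>I. r \<otimes> x = \<zero>}"
  have "ideal_prod R ?A I \<subseteq> {\<zero>}"
    by (simp add: ideal_prod_subset_iff[OF zeroideal])
  then have "?A \<subseteq> {\<zero>} \<or> I \<subseteq> {\<zero>}"
    using assms(1,2) left_annihilator_ideal[OF assms(2)]
    by (auto simp: prime_ring_def dest: twosided_prime_ideal.prime)
  moreover have "\<zero> \<in> I"
    using assms(2) by (simp add: additive_subgroup.zero_closed ideal.axioms(1))
  ultimately show ?thesis
    using assms(3) by (auto simp: left_faithful_def)
qed

lemma (in ring) prime_ring_if_primes_left_faithful:
  assumes nonzero: "carrier R \<noteq> {\<zero>}" and acc: "acc_on_ideals R"
    and primes: "\<And>P. \<lbrakk>twosided_prime_ideal P R; P \<noteq> {\<zero>}\<rbrakk> \<Longrightarrow> left_faithful R P"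
  shows "prime_ring R"
  unfolding prime_ring_def
proof (rule conjI[OF ring_axioms], rule twosided_prime_ideal.intro[OF zeroideal], unfold_locales)
  show "{\<zero>} \<noteq> carrier R"
    using nonzero by simp
next
  fix I J
  assume I: "ideal I R" and J: "ideal J R" and IJ: "ideal_prod R I J \<subseteq> {\<zero>}"
  show "I \<subseteq> {\<zero>} \<or> J \<subseteq> {\<zero>}"
  proof (rule ccontr)
    assume not_zero: "\<not> (I \<subseteq> {\<zero>} \<or> J \<subseteq> {\<zero>})"
    \<comment> \<open>Any nonzero element of \<open>I\<close> annihilates \<open>J\<close> from the
      left.\<close>
    then have "\<not> left_faithful R J"
      using IJ ideal.Icarr[OF I]
      unfolding ideal_prod_subset_iff[OF zeroideal] left_faithful_def by blast
    then obtain P where P: "ideal P R" "\<not> left_faithful R P" "J \<subseteq> P"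
      and max: "\<And>K. \<lbrakk>ideal K R; \<not> left_faithful R K; P \<subseteq> K\<rbrakk> \<Longrightarrow> K = P"
      using acc_on_ideals_maximal[OF acc, of "{K. ideal K R \<and> \<not> left_faithful R K}" J] J
      by (smt (verit) mem_Collect_eq)
    have "twosided_prime_ideal P R"
      by (rule P1_maximal_complement_prime[OF left_faithful_satisfies_P1]) (use P max in auto)
    \<comment> \<open>\<open>P\<close> contains the nonzero ideal \<open>J\<close>, so it is a
      nonzero prime and would have to be faithful.\<close>
    then show False
      using primes P(2,3) not_zero by blast
  qed
qed

theorem proposition3p6:
  fixes R :: "('a, 'b) ring_scheme" (structure)
  assumes "ring R" and "carrier R \<noteq> {\<zero>}"
  shows "satisfies_P1 R {I. ideal I R \<and> left_faithful R I} \<and>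
    (acc_on_ideals R \<longrightarrow>
      (prime_ring R \<longleftrightarrow>
        (\<forall>P. twosided_prime_ideal P R \<and> P \<noteq> {\<zero>} \<longrightarrow> left_faithful R P)))"
proof -
  interpret ring R by fact
  show ?thesis
    using left_faithful_satisfies_P1 prime_ring_left_faithful
      prime_ring_if_primes_left_faithful[OF assms(2)] twosided_prime_ideal.axioms(1)
    by blast
qed

end
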